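(* The dynamic $s$-$t$-reachability query cannot be maintained in $\mathrm{DynQF}$ with an invariant initialization mapping. This holds even when restricted to dynamic instances in which the initial graph and all graphs arising from the modifications are 1-layered $s$-$t$-graphs.
   Context: An $s$-$t$-graph is a structure over the schema with one binary relation symbol $E$ and two constants $s,t$; the $s$-$t$-reachability query is true iff there is a directed path from $s$ to $t$. A 1-layered $s$-$t$-graph is one where every edge goes from $s$ to a node of $V\setminus\{s,t\}$ or from such a node to $t$. Dynamic setting ($\mathrm{DynQF}$): relational input schema, auxiliary schema with relation and function symbols, no built-in data. Concrete modifications insert or delete a single tuple of an input relation (constants never modified). Update terms: variables and constants; $f(t_1,\dots,t_k)$ for a $k$-ary function symbol $f$ and update terms $t_i$; and $\mathrm{ite}(\phi,t_1,t_2)$ for a quantifier-free formula $\phi$ (possibly using update terms), evaluating to $t_1$ if $\phi$ holds and $t_2$ otherwise. The update program has for each auxiliary relation symbol $R$ and abstract modification $\delta$ a quantifier-free formula $\varphi^R_\delta(\vec x;\vec y)$ (possibly with update terms), and for each auxiliary function symbol $f$ an update term $t^f_\delta(\vec x;\vec y)$; after $\delta(\vec a)$, $R$ becomes $\{\vec b:\text{old state}\models\varphi^R_\delta(\vec a;\vec b)\}$ and $f(\vec b)$ becomes the value of $t^f_\delta(\vec a;\vec b)$ in the old state. A dynamic program has an initialization mapping $\mathrm{Init}$ from input databases to auxiliary structures over the same domain and a query symbol $Q$; it maintains a query if for every input database $\mathcal D$ (not necessarily empty) and every finite modification sequence $\alpha$, $Q$ in the state obtained by applying $\alpha$ to $(\mathcal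 D,\mathrm{Init}(\mathcal D))$ equals the query answer on $\alpha(\mathcal D)$. $\mathrm{Init}$ is invariant if $\pi(\mathrm{Init}(\mathcal D))=\mathrm{Init}(\pi(\mathcal D))$ for every input database $\mathcal D$ and every permutation $\pi$ of its domain. *)

theory Defs
  imports "HOL-Combinatorics.Permutations"
begin

record 'a stgraph =
  verts :: "'a set"
  edges :: "('a \<times> 'a) set"
  src :: 'a
  tgt :: 'a

definition st_graph :: "'a stgraph \<Rightarrow> bool" where
  "st_graph G \<longleftrightarrow> finite (verts G) \<and> edges G \<subseteq> verts G \<times> verts G
     \<and> src G \<in> verts G \<and> tgt G \<in> verts G"

definition one_layered :: "'a stgraph \<Rightarrow> bool" where
  "one_layered G \<longleftrightarrow> st_graph G \<and>
     (\<forall>(u, v) \<in> edges G. (u = src G \<and> v \<in> verts G - {src G, tgt G})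
                     \<or> (u \<in> verts G - {src G, tgt G} \<and> v = tgt G))"

definition st_reach :: "'a stgraph \<Rightarrow> bool" where
  "st_reach G \<longleftrightarrow> (src G, tgt G) \<in> (edges G)\<^sup>*"

definition graph_image :: "('a \<Rightarrow> 'a) \<Rightarrow> 'a stgraph \<Rightarrow> 'a stgraph" where
  "graph_image \<pi> G =
     \<lparr> verts = \<pi> ` verts G, edges = map_prod \<pi> \<pi> ` edges G, src = \<pi> (src G), tgt = \<pi> (tgt G) \<rparr>"

datatype modop = Ins | Del

type_synonym 'a modification = "modop \<times> 'a \<times> 'a"

fun apply_mod :: "'a modification \<Rightarrow> 'a stgraph \<Rightarrow> 'a stgraph" where
  "apply_mod (Ins, e) G = G\<lparr>edges := insert e (edges G)\<rparr>"
| "apply_mod (Del, e) G = G\<lparr>edges := edges G - {e}\<rparr>"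

definition apply_mods :: "'a modification list \<Rightarrow> 'a stgraph \<Rightarrow> 'a stgraph" where
  "apply_mods \<alpha> G = fold apply_mod \<alpha> G"

text \<open>Dynamic instances all of whose graphs, initial and intermediate, belong to the class \<open>C\<close>.\<close>
definition dyn_instance :: "('a stgraph \<Rightarrow> bool) \<Rightarrow> 'a stgraph \<Rightarrow> 'a modification list \<Rightarrow> bool" where
  "dyn_instance C G \<alpha> \<longleftrightarrow> st_graph G \<and> (\<forall>(d, a, b) \<in> set \<alpha>. a \<in> verts G \<and> b \<in> verts G)
     \<and> (\<forall>i \<le> length \<alpha>. C (apply_mods (take i \<alpha>) G))"

record ('r, 'f) schema =
  rel_syms :: "'r set"
  rel_ar :: "'r \<Rightarrow> nat"
  fun_syms :: "'f set"
  fun_ar :: "'f \<Rightarrow> nat"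

record ('r, 'f, 'a) aux =
  rels :: "'r \<Rightarrow> 'a list set"
  funs :: "'f \<Rightarrow> 'a list \<Rightarrow> 'a"

definition tuples :: "'a set \<Rightarrow> nat \<Rightarrow> 'a list set" where
  "tuples V k = {xs. set xs \<subseteq> V \<and> length xs = k}"

definition aux_structure :: "('r, 'f) schema \<Rightarrow> 'a set \<Rightarrow> ('r, 'f, 'a) aux \<Rightarrow> bool" where
  "aux_structure \<sigma> V A \<longleftrightarrow>
     (\<forall>R \<in> rel_syms \<sigma>. rels A R \<subseteq> tuples V (rel_ar \<sigma> R)) \<and>
     (\<forall>f \<in> fun_syms \<sigma>. \<forall>xs \<in> tuples V (fun_ar \<sigma> f). funs A f xs \<in> V)"

text \<open>Equality of two auxiliary structures over the domain \<open>V\<close>: values at symbols outside the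
  schema, and at tuples outside the domain or of the wrong length, are not part of the structure.\<close>
definition aux_eq :: "('r, 'f) schema \<Rightarrow> 'a set \<Rightarrow> ('r, 'f, 'a) aux \<Rightarrow> ('r, 'f, 'a) aux \<Rightarrow> bool" where
  "aux_eq \<sigma> V A B \<longleftrightarrow>
     (\<forall>R \<in> rel_syms \<sigma>. rels A R = rels B R) \<and>
     (\<forall>f \<in> fun_syms \<sigma>. \<forall>xs \<in> tuples V (fun_ar \<sigma> f). funs A f xs = funs B f xs)"

definition aux_image :: "('a \<Rightarrow> 'a) \<Rightarrow> ('r, 'f, 'a) aux \<Rightarrow> ('r, 'f, 'a) aux" where
  "aux_image \<pi> A =
     \<lparr> rels = (\<lambda>R. map \<pi> ` rels A R), funs = (\<lambda>f ys. \<pi> (funs A f (map (inv \<pi>) ys))) \<rparr>"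

text \<open>\<open>Par i\<close> is the \<open>i\<close>-th parameter of the modification, \<open>Arg j\<close> the \<open>j\<close>-th component of the
  tuple whose membership, or whose function value, is being updated.\<close>
datatype var = Par nat | Arg nat

datatype ('r, 'f) uterm =
    Var var
  | Src
  | Tgt
  | Fun 'f "('r, 'f) uterm list"
  | Ite "('r, 'f) qf" "('r, 'f) uterm" "('r, 'f) uterm"
and ('r, 'f) qf =
    Eq "('r, 'f) uterm" "('r, 'f) uterm"
  | Edge "('r, 'f) uterm" "('r, 'f) uterm"
  | Rel 'r "('r, 'f) uterm list"
  | Neg "('r, 'f) qf"
  | Conj "('r, 'f) qf" "('r, 'f) qf"
  | Disj "('r, 'f) qf" "('r, 'f) qf"

text \<open>\<open>wf_uterm \<sigma> n k\<close>: arities are respected, and only the first \<open>n\<close> parameters and the first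
  \<open>k\<close> arguments occur.\<close>
fun wf_uterm :: "('r, 'f) schema \<Rightarrow> nat \<Rightarrow> nat \<Rightarrow> ('r, 'f) uterm \<Rightarrow> bool"
  and wf_qf :: "('r, 'f) schema \<Rightarrow> nat \<Rightarrow> nat \<Rightarrow> ('r, 'f) qf \<Rightarrow> bool" where
  "wf_uterm \<sigma> n k (Var (Par i)) \<longleftrightarrow> i < n"
| "wf_uterm \<sigma> n k (Var (Arg j)) \<longleftrightarrow> j < k"
| "wf_uterm \<sigma> n k Src \<longleftrightarrow> True"
| "wf_uterm \<sigma> n k Tgt \<longleftrightarrow> True"
| "wf_uterm \<sigma> n k (Fun f ts) \<longleftrightarrow>
     f \<in> fun_syms \<sigma> \<and> length ts = fun_ar \<sigma> f \<and> (\<forall>t \<in> set ts. wf_uterm \<sigma> n k t)"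
| "wf_uterm \<sigma> n k (Ite \<phi> t u) \<longleftrightarrow> wf_qf \<sigma> n k \<phi> \<and> wf_uterm \<sigma> n k t \<and> wf_uterm \<sigma> n k u"
| "wf_qf \<sigma> n k (Eq t u) \<longleftrightarrow> wf_uterm \<sigma> n k t \<and> wf_uterm \<sigma> n k u"
| "wf_qf \<sigma> n k (Edge t u) \<longleftrightarrow> wf_uterm \<sigma> n k t \<and> wf_uterm \<sigma> n k u"
| "wf_qf \<sigma> n k (Rel R ts) \<longleftrightarrow>
     R \<in> rel_syms \<sigma> \<and> length ts = rel_ar \<sigma> R \<and> (\<forall>t \<in> set ts. wf_uterm \<sigma> n k t)"
| "wf_qf \<sigma> n k (Neg \<phi>) \<longleftrightarrow> wf_qf \<sigma> n k \<phi>"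
| "wf_qf \<sigma> n k (Conj \<phi> \<psi>) \<longleftrightarrow> wf_qf \<sigma> n k \<phi> \<and> wf_qf \<sigma> n k \<psi>"
| "wf_qf \<sigma> n k (Disj \<phi> \<psi>) \<longleftrightarrow> wf_qf \<sigma> n k \<phi> \<and> wf_qf \<sigma> n k \<psi>"

type_synonym ('r, 'f, 'a) state = "'a stgraph \<times> ('r, 'f, 'a) aux"

fun eval_uterm :: "('r, 'f, 'a) state \<Rightarrow> 'a list \<Rightarrow> 'a list \<Rightarrow> ('r, 'f) uterm \<Rightarrow> 'a"
  and eval_qf :: "('r, 'f, 'a) state \<Rightarrow> 'a list \<Rightarrow> 'a list \<Rightarrow> ('r, 'f) qf \<Rightarrow> bool" where
  "eval_uterm S as bs (Var (Par i)) = as ! i"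
| "eval_uterm S as bs (Var (Arg j)) = bs ! j"
| "eval_uterm S as bs Src = src (fst S)"
| "eval_uterm S as bs Tgt = tgt (fst S)"
| "eval_uterm S as bs (Fun f ts) = funs (snd S) f (map (eval_uterm S as bs) ts)"
| "eval_uterm S as bs (Ite \<phi> t u) =
     (if eval_qf S as bs \<phi> then eval_uterm S as bs t else eval_uterm S as bs u)"
| "eval_qf S as bs (Eq t u) \<longleftrightarrow> eval_uterm S as bs t = eval_uterm S as bs u"
| "eval_qf S as bs (Edge t u) \<longleftrightarrow> (eval_uterm S as bs t, eval_uterm S as bs u) \<in> edges (fst S)"
| "eval_qf S as bs (Rel R ts) \<longleftrightarrow> map (eval_uterm S as bs) ts \<in> rels (snd S) R"
| "eval_qf S as bs (Neg \<phi>) \<longleftrightarrow> \<not> eval_qf S as bs \<phi>"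
| "eval_qf S as bs (Conj \<phi> \<psi>) \<longleftrightarrow> eval_qf S as bs \<phi> \<and> eval_qf S as bs \<psi>"
| "eval_qf S as bs (Disj \<phi> \<psi>) \<longleftrightarrow> eval_qf S as bs \<phi> \<or> eval_qf S as bs \<psi>"

record ('r, 'f, 'a) dyn_program =
  schema :: "('r, 'f) schema"
  upd_formula :: "'r \<Rightarrow> modop \<Rightarrow> ('r, 'f) qf"
  upd_term :: "'f \<Rightarrow> modop \<Rightarrow> ('r, 'f) uterm"
  init :: "'a stgraph \<Rightarrow> ('r, 'f, 'a) aux"
  query :: 'r

text \<open>The query symbol is 0-ary, since only Boolean queries are considered.\<close>
definition DynQF :: "('r, 'f, 'a) dyn_program \<Rightarrow> bool" where
  "DynQF P \<longleftrightarrow>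
     finite (rel_syms (schema P)) \<and> finite (fun_syms (schema P)) \<and>
     query P \<in> rel_syms (schema P) \<and> rel_ar (schema P) (query P) = 0 \<and>
     (\<forall>R \<in> rel_syms (schema P). \<forall>d. wf_qf (schema P) 2 (rel_ar (schema P) R) (upd_formula P R d)) \<and>
     (\<forall>f \<in> fun_syms (schema P). \<forall>d. wf_uterm (schema P) 2 (fun_ar (schema P) f) (upd_term P f d)) \<and>
     (\<forall>G. st_graph G \<longrightarrow> aux_structure (schema P) (verts G) (init P G))"

fun step :: "('r, 'f, 'a) dyn_program \<Rightarrow> 'a modification \<Rightarrow> ('r, 'f, 'a) state \<Rightarrow> ('r, 'f, 'a) state"
  where
  "step P (d, a, b) S =
     (apply_mod (d, a, b) (fst S),
      \<lparr> rels = (\<lambda>R. {bs \<in> tuples (verts (fst S)) (rel_ar (schema P) R).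
                        eval_qf S [a, b] bs (upd_formula P R d)}),
        funs = (\<lambda>f bs. eval_uterm S [a, b] bs (upd_term P f d)) \<rparr>)"

definition run :: "('r, 'f, 'a) dyn_program \<Rightarrow> 'a stgraph \<Rightarrow> 'a modification list \<Rightarrow> ('r, 'f, 'a) state"
  where
  "run P G \<alpha> = fold (step P) \<alpha> (G, init P G)"

definition maintains_on ::
  "('a stgraph \<Rightarrow> bool) \<Rightarrow> ('r, 'f, 'a) dyn_program \<Rightarrow> ('a stgraph \<Rightarrow> bool) \<Rightarrow> bool" where
  "maintains_on C P q \<longleftrightarrow>
     (\<forall>G \<alpha>. dyn_instance C G \<alpha> \<longrightarrow>
        ([] \<in> rels (snd (run P G \<alpha>)) (query P) \<longleftrightarrow> q (apply_mods \<alpha> G)))"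

definition maintains :: "('r, 'f, 'a) dyn_program \<Rightarrow> ('a stgraph \<Rightarrow> bool) \<Rightarrow> bool" where
  "maintains P q \<longleftrightarrow> maintains_on st_graph P q"

definition invariant_init :: "('r, 'f, 'a) dyn_program \<Rightarrow> bool" where
  "invariant_init P \<longleftrightarrow>
     (\<forall>G \<pi>. st_graph G \<and> \<pi> permutes verts G \<longrightarrow>
        aux_eq (schema P) (verts G) (aux_image \<pi> (init P G)) (init P (graph_image \<pi> G)))"

end

theory Submission imports Defs "HOL-Library.FuncSet" begin

text \<open>
  Let \<open>G\<^sub>k\<close> be the 1-layered graph with \<open>k\<close> inner nodes and all possible edges, the inner node
  sets being nested. Every permutation of the inner nodes is an automorphism of \<open>G\<^sub>k\<close>, so an
  invariant initialization of \<open>G\<^sub>k\<close> is determined by its restriction to the source, the target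
  and \<open>m\<close> inner nodes, where \<open>m\<close> bounds all arities, and function values on that set stay inside
  it once \<open>k \<ge> m + 2\<close>. There are only finitely many such restrictions, so two of them agree,
  say for \<open>k < k'\<close>; then the initial state of \<open>G\<^sub>k\<close> is a substructure of that of \<open>G\<^sub>k\<^sub>'\<close>.
  Quantifier-free updates with parameters in a substructure preserve substructures. Hence deleting
  the edges from the \<open>k\<close> common inner nodes to the target yields the same answer in both graphs,
  although the target has become unreachable in \<open>G\<^sub>k\<close> only.
\<close>

section \<open>Substructures of states, and their preservation by updates\<close>

text \<open>The induced substructure relation between states, including closure of the smaller
  domain under constants and functions. As in \<open>aux_eq\<close>, only symbols of the schema and,
  for functions, well-formed tuples count.\<close>

definition substate :: "('r, 'f) schema \<Rightarrow> ('r, 'f, 'a) state \<Rightarrow> ('r, 'f, 'a) state \<Rightarrow> bool" where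
  "substate \<sigma> S T \<longleftrightarrow>
     verts (fst S) \<subseteq> verts (fst T) \<and> src (fst S) = src (fst T) \<and> tgt (fst S) = tgt (fst T) \<and>
     src (fst S) \<in> verts (fst S) \<and> tgt (fst S) \<in> verts (fst S) \<and>
     edges (fst S) = edges (fst T) \<inter> verts (fst S) \<times> verts (fst S) \<and>
     (\<forall>R \<in> rel_syms \<sigma>.
        rels (snd S) R = rels (snd T) R \<inter> tuples (verts (fst S)) (rel_ar \<sigma> R)) \<and>
     (\<forall>f \<in> fun_syms \<sigma>. \<forall>xs \<in> tuples (verts (fst S)) (fun_ar \<sigma> f).
        funs (snd S) f xs = funs (snd T) f xs \<and> funs (snd S) f xs \<in> verts (fst S))"

lemma substate_rels:
  "substate \<sigma> S T \<Longrightarrow> R \<in> rel_syms \<sigma> \<Longrightarrow>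
     rels (snd S) R = rels (snd T) R \<inter> tuples (verts (fst S)) (rel_ar \<sigma> R)"
  by (simp add: substate_def)

lemma substate_funs:
  assumes "substate \<sigma> S T" "f \<in> fun_syms \<sigma>" "xs \<in> tuples (verts (fst S)) (fun_ar \<sigma> f)"
  shows "funs (snd S) f xs = funs (snd T) f xs" "funs (snd S) f xs \<in> verts (fst S)"
  using assms unfolding substate_def by blast+

text \<open>Without quantifiers, evaluation visits only values generated from parameters, arguments
  and constants by the functions. Membership in the smaller domain is proved along with equality,
  since agreement of relations and functions is known only on tuples over that domain.\<close>

lemma eval_substate:
  assumes "substate \<sigma> S T" "as \<in> tuples (verts (fst S)) n" "bs \<in> tuples (verts (fst S)) k"
  shows eval_uterm_substate: "wf_uterm \<sigma> n k t \<Longrightarrow>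
          eval_uterm S as bs t = eval_uterm T as bs t \<and> eval_uterm S as bs t \<in> verts (fst S)"
    and eval_qf_substate: "wf_qf \<sigma> n k \<phi> \<Longrightarrow> eval_qf S as bs \<phi> = eval_qf T as bs \<phi>"
proof (induction t and \<phi>)
  case (Var v)
  then show ?case using assms(2,3) by (cases v) (auto simp: tuples_def)
next
  case Src
  then show ?case using assms(1) by (auto simp: substate_def)
next
  case Tgt
  then show ?case using assms(1) by (auto simp: substate_def)
next
  case (Fun f ts)
  have "eval_uterm S as bs t = eval_uterm T as bs t" "eval_uterm S as bs t \<in> verts (fst S)"
    if "t \<in> set ts" for t
    using Fun.IH[OF that] Fun.prems that unfolding wf_uterm.simps by blast+
  then have "map (eval_uterm S as bs) ts = map (eval_uterm T as bs) ts"
    and "map (eval_uterm S as bs) ts \<in> tuples (verts (fst S)) (fun_ar \<sigma> f)"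
    using Fun.prems by (simp_all add: tuples_def image_subset_iff)
  with Fun.prems substate_funs[OF assms(1)] show ?case
    by (metis eval_uterm.simps(5) wf_uterm.simps(5))
next
  case (Rel R ts)
  have "eval_uterm S as bs t = eval_uterm T as bs t" "eval_uterm S as bs t \<in> verts (fst S)"
    if "t \<in> set ts" for t
    using Rel.IH[OF that] Rel.prems that unfolding wf_qf.simps by blast+
  then have "map (eval_uterm S as bs) ts = map (eval_uterm T as bs) ts"
    and "map (eval_uterm S as bs) ts \<in> tuples (verts (fst S)) (rel_ar \<sigma> R)"
    using Rel.prems by (simp_all add: tuples_def image_subset_iff)
  with Rel.prems substate_rels[OF assms(1)] show ?case
    by (metis IntE IntI eval_qf.simps(3) wf_qf.simps(3))
next
  case (Edge t u)
  then show ?case using assms(1) by (auto simp: substate_def)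
qed auto

lemma verts_apply_mod [simp]: "verts (apply_mod m G) = verts G"
  and src_apply_mod [simp]: "src (apply_mod m G) = src G"
  and tgt_apply_mod [simp]: "tgt (apply_mod m G) = tgt G"
  by (cases "(m, G)" rule: apply_mod.cases; simp)+

lemma step_substate:
  assumes "DynQF P" "substate (schema P) S T" "a \<in> verts (fst S)" "b \<in> verts (fst S)"
  shows "substate (schema P) (step P (d, a, b) S) (step P (d, a, b) T)"
proof -
  let ?V = "verts (fst S)" and ?\<sigma> = "schema P"
  have ab: "[a, b] \<in> tuples ?V 2" using assms(3,4) by (simp add: tuples_def)
  have "?V \<subseteq> verts (fst T)" using assms(2) by (simp add: substate_def)
  \<comment> \<open>\<open>step\<close> restricts a new relation to tuples over the state's own
    domain; tuples over the smaller domain pass this filter in both states.\<close>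
  then have sub: "tuples ?V n \<subseteq> tuples (verts (fst T)) n" for n by (auto simp: tuples_def)
  have qf: "eval_qf S [a, b] bs (upd_formula P R d) = eval_qf T [a, b] bs (upd_formula P R d)"
    if "R \<in> rel_syms ?\<sigma>" "bs \<in> tuples ?V (rel_ar ?\<sigma> R)" for R bs
    using eval_qf_substate[OF assms(2) ab that(2)] assms(1) that(1) by (simp add: DynQF_def)
  have "rels (snd (step P (d, a, b) S)) R
      = rels (snd (step P (d, a, b) T)) R \<inter> tuples ?V (rel_ar ?\<sigma> R)"
    if "R \<in> rel_syms ?\<sigma>" for R
    using qf[OF that] sub[of "rel_ar ?\<sigma> R"] by auto
  moreover have "eval_uterm S [a, b] bs (upd_term P f d) = eval_uterm T [a, b] bs (upd_term P f d)
      \<and> eval_uterm S [a, b] bs (upd_term P f d) \<in> ?V"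
    if "f \<in> fun_syms ?\<sigma>" "bs \<in> tuples ?V (fun_ar ?\<sigma> f)" for f bs
    using eval_uterm_substate[OF assms(2) ab that(2)] assms(1) that(1) unfolding DynQF_def by blast
  moreover have "edges (apply_mod (d, a, b) (fst S))
      = edges (apply_mod (d, a, b) (fst T)) \<inter> ?V \<times> ?V"
    using assms(2-4) by (cases d) (auto simp: substate_def)
  moreover have "src (fst S) = src (fst T)" "tgt (fst S) = tgt (fst T)"
    "src (fst S) \<in> ?V" "tgt (fst S) \<in> ?V"
    using assms(2) unfolding substate_def by blast+
  ultimately show ?thesis
    using \<open>?V \<subseteq> verts (fst T)\<close> unfolding substate_def
    by (simp only: step.simps fst_conv snd_conv aux.simps verts_apply_mod src_apply_mod
        tgt_apply_mod) blast
qed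

lemma fold_step_substate:
  assumes "DynQF P" "substate (schema P) S T"
    and "\<forall>(d, a, b) \<in> set \<alpha>. a \<in> verts (fst S) \<and> b \<in> verts (fst S)"
  shows "substate (schema P) (fold (step P) \<alpha> S) (fold (step P) \<alpha> T)"
  using assms(2,3)
proof (induction \<alpha> arbitrary: S T)
  case (Cons m \<alpha>)
  obtain d a b where m: "m = (d, a, b)" by (cases m)
  with Cons.prems have "substate (schema P) (step P m S) (step P m T)"
    using step_substate[OF assms(1)] by auto
  then show ?case using Cons.prems(2) by (auto intro!: Cons.IH simp: m)
qed simp

section \<open>Complete 1-layered graphs and their symmetries\<close>

definition full_layer :: "'a \<Rightarrow> 'a \<Rightarrow> 'a set \<Rightarrow> 'a stgraph" where
  "full_layer s t A =
     \<lparr> verts = insert s (insert t A), edges = {s} \<times> A \<union> A \<times> {t}, src = s, tgt = t \<rparr>"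

lemma full_layer_simps [simp]:
  "verts (full_layer s t A) = insert s (insert t A)"
  "edges (full_layer s t A) = {s} \<times> A \<union> A \<times> {t}"
  "src (full_layer s t A) = s"
  "tgt (full_layer s t A) = t"
  by (simp_all add: full_layer_def)

lemma one_layered_full_layer:
  "finite A \<Longrightarrow> s \<notin> A \<Longrightarrow> t \<notin> A \<Longrightarrow> one_layered (full_layer s t A)"
  by (auto simp: one_layered_def st_graph_def)

lemma st_graph_full_layer: "finite A \<Longrightarrow> st_graph (full_layer s t A)"
  by (auto simp: st_graph_def)

lemma graph_image_full_layer:
  assumes "\<pi> permutes A" "s \<notin> A" "t \<notin> A"
  shows "graph_image \<pi> (full_layer s t A) = full_layer s t A"
proof -
  have "\<pi> s = s" "\<pi> t = t" "\<pi> ` A = A"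
    using assms by (auto simp: permutes_not_in permutes_image)
  moreover from this have "map_prod \<pi> \<pi> ` ({s} \<times> A \<union> A \<times> {t}) = {s} \<times> A \<union> A \<times> {t}"
    by (simp add: image_Un map_prod_surj_on[of \<pi> "{s}" "{s}" \<pi> A A]
        map_prod_surj_on[of \<pi> A A \<pi> "{t}" "{t}"])
  ultimately show ?thesis by (simp add: graph_image_def full_layer_def)
qed

text \<open>A permutation of the inner nodes fixes \<open>s\<close> and \<open>t\<close> and is an
  automorphism of the graph, so invariance makes it an automorphism of the initial auxiliary
  structure.\<close>

lemma invariant_init_full_layer:
  assumes "invariant_init P" "finite A" "s \<notin> A" "t \<notin> A" "\<pi> permutes A"
  defines "I \<equiv> init P (full_layer s t A)"
  shows "R \<in> rel_syms (schema P) \<Longrightarrow> map \<pi> xs \<in> rels I R \<longleftrightarrow> xs \<in> rels I R"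
    and "f \<in> fun_syms (schema P) \<Longrightarrow> xs \<in> tuples (insert s (insert t A)) (fun_ar (schema P) f)
           \<Longrightarrow> funs I f (map \<pi> xs) = \<pi> (funs I f xs)"
proof -
  let ?V = "insert s (insert t A)"
  have perm: "\<pi> permutes ?V" by (rule permutes_subset[OF assms(5)]) auto
  have inj: "inj \<pi>" using perm by (rule permutes_inj)
  from assms(1)[unfolded invariant_init_def, rule_format, of "full_layer s t A" \<pi>] perm
  have eq: "aux_eq (schema P) ?V (aux_image \<pi> I) I"
    by (simp add: I_def graph_image_full_layer[OF assms(5,3,4)] st_graph_full_layer[OF assms(2)])
  show "map \<pi> xs \<in> rels I R \<longleftrightarrow> xs \<in> rels I R" if "R \<in> rel_syms (schema P)"
  proof -
    have "map \<pi> ` rels I R = rels I R" using eq that by (simp add: aux_eq_def aux_image_def)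
    then show ?thesis using inj by (metis inj_image_mem_iff inj_mapI)
  qed
  show "funs I f (map \<pi> xs) = \<pi> (funs I f xs)"
    if "f \<in> fun_syms (schema P)" "xs \<in> tuples ?V (fun_ar (schema P) f)"
  proof -
    have "map \<pi> xs \<in> tuples ?V (fun_ar (schema P) f)"
      using that(2) permutes_image[OF perm] by (auto simp: tuples_def)
    then have "funs I f (map \<pi> xs) = \<pi> (funs I f (map (inv \<pi>) (map \<pi> xs)))"
      using eq that(1) by (simp add: aux_eq_def aux_image_def del: map_map)
    then show ?thesis using inj by simp
  qed
qed

text \<open>A value \<open>v\<close> outside would be an inner node not in \<open>B\<close>. The
  margin of 2 leaves another such node \<open>w\<close>; transposing \<open>v\<close> and
  \<open>w\<close> fixes every entry of \<open>xs\<close>, hence would have to fix the value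
  \<open>v\<close>.\<close>

lemma funs_init_full_layer_closed:
  assumes "DynQF P" "invariant_init P" "finite A" "s \<notin> A" "t \<notin> A"
    and "B \<subseteq> A" "card B + 2 \<le> card A" "f \<in> fun_syms (schema P)"
    and "xs \<in> tuples (insert s (insert t B)) (fun_ar (schema P) f)"
  shows "funs (init P (full_layer s t A)) f xs \<in> insert s (insert t B)"
proof (rule ccontr)
  define v where "v = funs (init P (full_layer s t A)) f xs"
  assume "funs (init P (full_layer s t A)) f xs \<notin> insert s (insert t B)"
  then have v: "v \<notin> insert s (insert t B)" by (simp add: v_def)
  have xs: "xs \<in> tuples (insert s (insert t A)) (fun_ar (schema P) f)"
    using assms(6,9) by (auto simp: tuples_def)
  have "aux_structure (schema P) (insert s (insert t A)) (init P (full_layer s t A))"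
    using assms(1) st_graph_full_layer[OF assms(3)]
    unfolding DynQF_def by (metis full_layer_simps(1))
  then have "v \<in> insert s (insert t A)"
    using assms(8) xs by (simp add: aux_structure_def v_def)
  with v have vA: "v \<in> A" by simp
  have "card (insert v B) < card A"
    using assms(7) by (intro le_less_trans[OF card_insert_le_m1[of "card B + 1"]]) auto
  then obtain w where w: "w \<in> A" "w \<notin> insert v B"
    by (metis assms(3,6) card_mono finite_insert finite_subset not_less subsetI)
  let ?\<pi> = "transpose v w"
  have perm: "?\<pi> permutes A" using vA w by (simp add: permutes_swap_id)
  have "map ?\<pi> xs = xs"
    using assms(4,5,9) v w vA
    by (intro map_idI) (auto simp: tuples_def intro!: transpose_apply_other)
  with invariant_init_full_layer(2)[OF assms(2-5) perm assms(8) xs]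
  have "?\<pi> v = v" by (simp add: v_def)
  with w show False by simp
qed

text \<open>A bijection from \<open>X\<close> onto some \<open>Y\<close> inside \<open>B\<close>
  extends to all of \<open>A\<close>, because the complements of \<open>X\<close> and
  \<open>Y\<close> in \<open>A\<close> are equally large.\<close>

lemma permutes_image_subset_exists:
  assumes "finite A" "X \<subseteq> A" "B \<subseteq> A" "card X \<le> card B"
  obtains \<pi> where "\<pi> permutes A" "\<pi> ` X \<subseteq> B"
proof -
  obtain Y where Y: "Y \<subseteq> B" "card Y = card X"
    using assms(4) obtain_subset_with_card_n by metis
  have fin: "finite X" "finite Y" using assms Y by (meson finite_subset subset_trans)+
  have "card (A - X) = card (A - Y)"
    using assms Y fin by (simp add: card_Diff_subset subset_trans[OF Y(1)])
  then obtain g h where g: "bij_betw g X Y" and h: "bij_betw h (A - X) (A - Y)"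
    using Y fin assms(1) finite_same_card_bij by (metis finite_Diff)
  let ?\<pi> = "\<lambda>x. if x \<in> X then g x else if x \<in> A then h x else x"
  have "bij_betw ?\<pi> X Y" by (rule bij_betw_cong[THEN iffD1, OF _ g]) simp
  moreover have "bij_betw ?\<pi> (A - X) (A - Y)" by (rule bij_betw_cong[THEN iffD1, OF _ h]) simp
  ultimately have "bij_betw ?\<pi> (X \<union> (A - X)) (Y \<union> (A - Y))"
    by (rule bij_betw_combine) auto
  moreover have "X \<union> (A - X) = A" "Y \<union> (A - Y) = A" using assms Y by auto
  ultimately have "?\<pi> permutes A" using assms(2) by (intro bij_imp_permutes) auto
  moreover have "?\<pi> ` X \<subseteq> B" using g Y(1) by (auto simp: bij_betw_def)
  ultimately show ?thesis by (rule that)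
qed

text \<open>Agreement on tuples over \<open>B\<close>, \<open>s\<close> and \<open>t\<close>
  suffices: symmetry carries every tuple over the smaller graph, of length at most
  \<open>card B\<close>, into that range.\<close>

lemma substate_init_full_layer:
  assumes "DynQF P" "invariant_init P" "s \<notin> A'" "t \<notin> A'"
    and "finite A'" "A \<subseteq> A'" "B \<subseteq> A"
    and ar: "\<forall>R \<in> rel_syms (schema P). rel_ar (schema P) R \<le> card B"
      "\<forall>f \<in> fun_syms (schema P). fun_ar (schema P) f \<le> card B"
    and rels_eq: "\<And>R. R \<in> rel_syms (schema P) \<Longrightarrow>
      rels (init P (full_layer s t A)) R \<inter> tuples (insert s (insert t B)) (rel_ar (schema P) R) =
      rels (init P (full_layer s t A')) R \<inter> tuples (insert s (insert t B)) (rel_ar (schema P) R)"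
    and funs_eq: "\<And>f xs. f \<in> fun_syms (schema P) \<Longrightarrow>
      xs \<in> tuples (insert s (insert t B)) (fun_ar (schema P) f) \<Longrightarrow>
      funs (init P (full_layer s t A)) f xs = funs (init P (full_layer s t A')) f xs"
  shows "substate (schema P) (full_layer s t A, init P (full_layer s t A))
           (full_layer s t A', init P (full_layer s t A'))"
proof -
  let ?\<sigma> = "schema P" and ?V = "insert s (insert t A)" and ?W = "insert s (insert t B)"
  let ?I = "init P (full_layer s t A)" and ?J = "init P (full_layer s t A')"
  have finA: "finite A" and st: "s \<notin> A" "t \<notin> A" using assms(3-6) finite_subset by auto
  have "aux_structure ?\<sigma> ?V ?I"
    using assms(1) st_graph_full_layer[OF finA]
    unfolding DynQF_def by (metis full_layer_simps(1))
  then have relsV: "\<And>R. R \<in> rel_syms ?\<sigma> \<Longrightarrow> rels ?I R \<subseteq> tuples ?V (rel_ar ?\<sigma> R)"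
    and funsV: "\<And>f xs. f \<in> fun_syms ?\<sigma> \<Longrightarrow> xs \<in> tuples ?V (fun_ar ?\<sigma> f) \<Longrightarrow>
      funs ?I f xs \<in> ?V"
    unfolding aux_structure_def by blast+
  \<comment> \<open>The tuple has at most \<open>card B\<close> inner nodes. One permutation serves
    both graphs, as a permutation of \<open>A\<close> is also one of \<open>A'\<close>.\<close>
  have move: "\<exists>\<pi>. \<pi> permutes A \<and> \<pi> permutes A' \<and> map \<pi> xs \<in> tuples ?W n"
    if "xs \<in> tuples ?V n" "n \<le> card B" for xs n
  proof -
    have "card (set xs \<inter> A) \<le> card B"
      using that card_length[of xs] card_mono[of "set xs" "set xs \<inter> A"] by (auto simp: tuples_def)
    then obtain \<pi> where \<pi>: "\<pi> permutes A" "\<pi> ` (set xs \<inter> A) \<subseteq> B"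
      using permutes_image_subset_exists[OF finA _ assms(7)] by (metis inf_le2)
    moreover have "\<pi> s = s" "\<pi> t = t" using \<pi>(1) st by (auto simp: permutes_not_in)
    ultimately have "map \<pi> xs \<in> tuples ?W n" using that(1) by (auto simp: tuples_def)
    then show ?thesis using \<pi>(1) permutes_subset[OF \<pi>(1) assms(6)] by blast
  qed
  have "rels ?I R = rels ?J R \<inter> tuples ?V (rel_ar ?\<sigma> R)" if R: "R \<in> rel_syms ?\<sigma>" for R
  proof -
    have "xs \<in> rels ?I R \<longleftrightarrow> xs \<in> rels ?J R" if xs: "xs \<in> tuples ?V (rel_ar ?\<sigma> R)" for xs
    proof -
      obtain \<pi> where \<pi>: "\<pi> permutes A" "\<pi> permutes A'" "map \<pi> xs \<in> tuples ?W (rel_ar ?\<sigma> R)"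
        using move[OF xs] ar(1) R by blast
      then show ?thesis
        using invariant_init_full_layer(1)[OF assms(2) finA st \<pi>(1) R]
          invariant_init_full_layer(1)[OF assms(2,5,3,4) \<pi>(2) R] rels_eq[OF R] by blast
    qed
    then show ?thesis using relsV[OF R] by blast
  qed
  moreover have "funs ?I f xs = funs ?J f xs"
    if f: "f \<in> fun_syms ?\<sigma>" and xs: "xs \<in> tuples ?V (fun_ar ?\<sigma> f)" for f xs
  proof -
    obtain \<pi> where \<pi>: "\<pi> permutes A" "\<pi> permutes A'" "map \<pi> xs \<in> tuples ?W (fun_ar ?\<sigma> f)"
      using move[OF xs] ar(2) f by blast
    have xs': "xs \<in> tuples (insert s (insert t A')) (fun_ar ?\<sigma> f)"
      using xs assms(6) by (auto simp: tuples_def)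
    have "\<pi> (funs ?I f xs) = \<pi> (funs ?J f xs)"
      using invariant_init_full_layer(2)[OF assms(2) finA st \<pi>(1) f xs]
        invariant_init_full_layer(2)[OF assms(2,5,3,4) \<pi>(2) f xs'] funs_eq[OF f \<pi>(3)] by simp
    then show ?thesis using permutes_inj[OF \<pi>(1)] by (simp add: inj_eq)
  qed
  ultimately show ?thesis
    using funsV assms(3,4,6) st unfolding substate_def by auto
qed

lemma apply_mods_Del: "apply_mods (map (Pair Del) es) G = G\<lparr>edges := edges G - set es\<rparr>"
proof (induction es arbitrary: G)
  case (Cons e es)
  have "apply_mods (map (Pair Del) (e # es)) G
      = apply_mods (map (Pair Del) es) (G\<lparr>edges := edges G - {e}\<rparr>)"
    by (simp add: apply_mods_def)
  then show ?case using Cons.IH by (simp flip: Diff_insert2)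
qed (simp add: apply_mods_def)

text \<open>Being 1-layered survives the removal of any edges, so all intermediate graphs qualify;
  taking \<open>es\<close> from the edges puts the parameters into the domain.\<close>

lemma dyn_instance_Del:
  assumes "one_layered G" "set es \<subseteq> edges G"
  shows "dyn_instance one_layered G (map (Pair Del) es)"
proof -
  have "one_layered (G\<lparr>edges := edges G - E\<rparr>)" for E
    using assms(1) unfolding one_layered_def st_graph_def by auto
  moreover have "st_graph G" using assms(1) by (simp add: one_layered_def)
  ultimately show ?thesis using assms(2)
    by (auto simp: dyn_instance_def take_map apply_mods_Del st_graph_def)
qed

section \<open>Pigeonhole argument and contradiction\<close>

lemma finite_tuples: "finite V \<Longrightarrow> finite (tuples V n)"
  unfolding tuples_def by (rule finite_lists_length_eq)

lemma not_maintains_on_one_layered: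
  fixes P :: "('r, 'f, 'a) dyn_program"
  assumes "infinite (UNIV :: 'a set)" "DynQF P" "invariant_init P"
  shows "\<not> maintains_on one_layered P st_reach"
proof
  assume maint: "maintains_on one_layered P st_reach"
  let ?\<sigma> = "schema P"
  obtain e :: "nat \<Rightarrow> 'a" where e: "inj e"
    using assms(1) infinite_countable_subset by blast
  \<comment> \<open>The indices 0 and 1 are reserved for \<open>s\<close> and \<open>t\<close>, so
    the nested sets \<open>A k\<close> start at index 2 and have exactly \<open>k\<close>
    elements.\<close>
  define s t A where "s = e 0" and "t = e 1" and "A k = e ` {2..<k + 2}" for k
  define G where "G k = full_layer s t (A k)" for k
  have "s \<noteq> t" using e by (simp add: s_def t_def inj_eq)
  have fin: "finite (A k)" and stA: "s \<notin> A k" "t \<notin> A k" for k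
    using e by (auto simp: A_def s_def t_def inj_eq)
  have card: "card (A k) = k" for k
    using e by (simp add: A_def card_image inj_on_subset)
  have mono: "A k \<subseteq> A l" if "k \<le> l" for k l
    using that by (auto simp: A_def)
  have psub: "\<exists>a. a \<in> A l \<and> a \<notin> A k" if "k < l" for k l
    using that mono[of k l] card[of k] card[of l]
    by (metis less_irrefl subsetI subset_antisym less_imp_le)

  obtain m where m: "\<forall>R \<in> rel_syms ?\<sigma>. rel_ar ?\<sigma> R \<le> m" "\<forall>f \<in> fun_syms ?\<sigma>. fun_ar ?\<sigma> f \<le> m"
  proof -
    have "finite (rel_ar ?\<sigma> ` rel_syms ?\<sigma> \<union> fun_ar ?\<sigma> ` fun_syms ?\<sigma>)"
      using assms(2) by (simp add: DynQF_def)
    then obtain m where "\<forall>n \<in> rel_ar ?\<sigma> ` rel_syms ?\<sigma> \<union> fun_ar ?\<sigma> ` fun_syms ?\<sigma>. n \<le> m"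
      using finite_nat_set_iff_bounded_le by blast
    then show ?thesis by (intro that) auto
  qed
  define W where "W = insert s (insert t (A m))"
  \<comment> \<open>\<open>rpart\<close> and \<open>fpart\<close> record the initial structure on
    \<open>W\<close> as extensional functions, so that they can be counted as elements of
    \<open>PiE\<close> sets.\<close>
  define rpart where "rpart k = (\<lambda>R \<in> rel_syms ?\<sigma>. rels (init P (G k)) R \<inter> tuples W (rel_ar ?\<sigma> R))"
    for k
  define fdom where "fdom = Sigma (fun_syms ?\<sigma>) (\<lambda>f. tuples W (fun_ar ?\<sigma> f))"
  define fpart where "fpart k = (\<lambda>(f, xs) \<in> fdom. funs (init P (G k)) f xs)" for k
  have finW: "finite W" by (simp add: W_def fin)
  \<comment> \<open>Pigeonhole: from \<open>m + 2\<close> on, function values on \<open>W\<close>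
    stay in \<open>W\<close>, which confines the pairs to a finite set.\<close>
  have "\<not> inj_on (\<lambda>k. (rpart k, fpart k)) {m + 2..}"
  proof
    assume "inj_on (\<lambda>k. (rpart k, fpart k)) {m + 2..}"
    moreover have "(\<lambda>k. (rpart k, fpart k)) ` {m + 2..} \<subseteq>
        (PiE (rel_syms ?\<sigma>) (\<lambda>R. Pow (tuples W (rel_ar ?\<sigma> R)))) \<times> (PiE fdom (\<lambda>_. W))"
    proof (intro image_subsetI SigmaI)
      fix k assume k: "k \<in> {m + 2..}"
      show "rpart k \<in> PiE (rel_syms ?\<sigma>) (\<lambda>R. Pow (tuples W (rel_ar ?\<sigma> R)))"
        by (auto simp: rpart_def)
      show "fpart k \<in> PiE fdom (\<lambda>_. W)"
      proof (rule PiE_I)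
        fix p assume p: "p \<in> fdom"
        then obtain f xs where fxs: "p = (f, xs)" "f \<in> fun_syms ?\<sigma>" "xs \<in> tuples W (fun_ar ?\<sigma> f)"
          by (auto simp: fdom_def)
        have "funs (init P (G k)) f xs \<in> W"
          unfolding G_def W_def
          using k fxs(2,3)
          by (intro funs_init_full_layer_closed[OF assms(2,3) fin stA])
            (simp_all add: mono card W_def)
        with p fxs(1) show "fpart k p \<in> W" by (simp add: fpart_def)
      qed (simp add: fpart_def)
    qed
    moreover have "finite \<dots>"
    proof (intro finite_cartesian_product finite_PiE)
      show "finite (rel_syms ?\<sigma>)" using assms(2) by (simp add: DynQF_def)
      show "finite fdom" using assms(2) finW
        by (auto simp: DynQF_def fdom_def finite_tuples)
    qed (use finW in \<open>simp_all add: finite_tuples\<close>)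
    ultimately have "finite {m + 2..}" by (rule inj_on_finite)
    then show False by (simp add: infinite_Ici)
  qed
  then obtain k l where kl: "m + 2 \<le> k" "k < l" "rpart k = rpart l" "fpart k = fpart l"
    unfolding inj_on_def by (metis atLeast_iff linorder_neqE_nat prod.inject)

  have sub: "substate ?\<sigma> (G k, init P (G k)) (G l, init P (G l))"
    unfolding G_def
  proof (rule substate_init_full_layer[OF assms(2,3) stA fin])
    show "A k \<subseteq> A l" "A m \<subseteq> A k" using kl by (auto intro!: mono)
    show "rels (init P (full_layer s t (A k))) R \<inter> tuples (insert s (insert t (A m))) (rel_ar ?\<sigma> R)
        = rels (init P (full_layer s t (A l))) R \<inter> tuples (insert s (insert t (A m))) (rel_ar ?\<sigma> R)"
      if "R \<in> rel_syms ?\<sigma>" for R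
      using fun_cong[OF kl(3), of R] that by (simp add: rpart_def W_def G_def)
    show "funs (init P (full_layer s t (A k))) f xs = funs (init P (full_layer s t (A l))) f xs"
      if "f \<in> fun_syms ?\<sigma>" "xs \<in> tuples (insert s (insert t (A m))) (fun_ar ?\<sigma> f)" for f xs
      using fun_cong[OF kl(4), of "(f, xs)"] that by (simp add: fpart_def fdom_def W_def G_def)
  qed (use m card in auto)

  \<comment> \<open>The deletions mention only nodes of the smaller graph, so the same sequence runs
    in both.\<close>
  obtain as where as: "set as = A k" using fin finite_list by blast
  define es where "es = map (\<lambda>a. (a, t)) as"
  have es: "set es = A k \<times> {t}" by (auto simp: es_def as)
  let ?\<alpha> = "map (Pair Del) es"
  have "substate ?\<sigma> (run P (G k) ?\<alpha>) (run P (G l) ?\<alpha>)"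
    unfolding run_def
    by (rule fold_step_substate[OF assms(2) sub]) (auto simp: es G_def)
  \<comment> \<open>The query symbol is 0-ary and the empty tuple lies over every domain, so the
    substructure relation transfers the answer.\<close>
  then have "[] \<in> rels (snd (run P (G k) ?\<alpha>)) (query P) \<longleftrightarrow>
      [] \<in> rels (snd (run P (G l) ?\<alpha>)) (query P)"
    using assms(2) by (auto simp: substate_def DynQF_def tuples_def)
  moreover have "dyn_instance one_layered (G j) ?\<alpha>" if "k \<le> j" for j
    using that mono[of k j]
    by (intro dyn_instance_Del) (auto simp: G_def es one_layered_full_layer fin stA)
  ultimately have "st_reach (apply_mods ?\<alpha> (G k)) \<longleftrightarrow> st_reach (apply_mods ?\<alpha> (G l))"
    using maint kl(2) by (simp add: maintains_on_def)
  \<comment> \<open>No edge enters \<open>t\<close> any more, and \<open>s \<noteq> t\<close> rules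
    out the empty path.\<close>
  moreover have "\<not> st_reach (apply_mods ?\<alpha> (G k))"
    using \<open>s \<noteq> t\<close> stA by (auto simp: st_reach_def apply_mods_Del G_def es elim: rtranclE)
  moreover have "st_reach (apply_mods ?\<alpha> (G l))"
  proof -
    \<comment> \<open>An inner node beyond \<open>A k\<close> keeps both of its edges.\<close>
    obtain a where a: "a \<in> A l" "a \<notin> A k" using psub[OF kl(2)] by blast
    then have "(s, a) \<in> edges (apply_mods ?\<alpha> (G l))" "(a, t) \<in> edges (apply_mods ?\<alpha> (G l))"
      using stA by (auto simp: apply_mods_Del G_def es)
    then show ?thesis
      by (auto simp: st_reach_def apply_mods_Del G_def intro: rtrancl_trans)
  qed
  ultimately show False by simp
qed

theorem theorem5p10:
  assumes "infinite (UNIV :: 'a set)"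
  shows "(\<nexists>P :: ('r, 'f, 'a) dyn_program.
            DynQF P \<and> invariant_init P \<and> maintains P st_reach)
       \<and> (\<nexists>P :: ('r, 'f, 'a) dyn_program.
            DynQF P \<and> invariant_init P \<and> maintains_on one_layered P st_reach)"
proof -
  \<comment> \<open>Instances through 1-layered graphs are instances through arbitrary ones, so the
    restricted claim implies the general one.\<close>
  have "maintains_on one_layered P st_reach" if "maintains P st_reach"
    for P :: "('r, 'f, 'a) dyn_program"
    using that unfolding maintains_def maintains_on_def dyn_instance_def one_layered_def by blast
  then show ?thesis using not_maintains_on_one_layered[OF assms] by blast
qed

end
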